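(* Let $H$ be a hypergraph and $W\in\mathfrak{U}(H)$ a unit. Let $L_H$ be any one of the Laplacian matrices $L^{(1)}$, $L^{(2)}$, $\Delta$ of $H$. Then the diffusion process $(L_H,\mathbb{R}^{V(H)})$, i.e. $x_{t+1}=L_Hx_t$, is forward invariant in $C_W$; that is, $L_Hx\in C_W$ for every $x\in C_W$.
   Context: A hypergraph $H=(V(H),E(H))$ consists of a finite nonempty vertex set $V(H)$ and a finite family $E(H)$ of nonempty subsets of $V(H)$, called hyperedges. The star of a vertex $i$ is $E_i(H)=\{e\in E(H): i\in e\}$. The units of $H$ are the equivalence classes of the relation $\{(i,j): E_i(H)=E_j(H)\}$ on $V(H)$; $\mathfrak{U}(H)$ is the set of all units. For $U\subseteq V(H)$, $C_U=\{x\in\mathbb{R}^{V(H)}: \text{there is } c_x\in\mathbb{R} \text{ with } x(i)=c_x \text{ for all } i\in U\}$. Matrices indexed by $V(H)$: $A^{(1)}$ has $A^{(1)}_{ij}=|E_i(H)\cap E_j(H)|$ for $i\neq j$ and zero diagonal; $A^{(2)}$ has $A^{(2)}_{ij}=\sum_{e\in E_i(H)\cap E_j(H)}\frac{1}{|e|-1}$ for $i\neq j$ and zero diagonal; $\mathcal{A}$ has $\mathcal{A}_{ij}=\frac{1}{|E_i(H)|}\sum_{e\in E_i(H)\cap E_j(H)}\frac{1}{|e|-1}$ for $i\ne j$ (equal to $0$ when $E_i(H)\cap E_j(H)=\emptyset$) and zero diagonal. For $s=1,2$, $D^{(s)}$ is the diagonal matrix whose $i$-th diagonal entry is the $i$-th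 row sum of $A^{(s)}$. The Laplacians are $L^{(1)}=D^{(1)}-A^{(1)}$, $L^{(2)}=D^{(2)}-A^{(2)}$, and the normalized Laplacian $\Delta=I-\mathcal{A}$, with $I$ the identity matrix. (For hyperedges of size $1$ in the row sums defining $D^{(s)}$ there is no contribution, since only off-diagonal entries are nonzero.) *)

theory Defs
  imports "HOL-Analysis.Analysis"
begin

(* The vertex set V(H) is the whole finite type 'v (finite and nonempty, as every type is), so that
   R^(V(H)) is real^'v and matrices indexed by V(H) are real^'v^'v.  A hypergraph is then given by
   its set E of hyperedges. *)

definition hypergraph :: "'v::finite set set \<Rightarrow> bool" where
  "hypergraph E \<longleftrightarrow> finite E \<and> {} \<notin> E"

definition hstar :: "'v::finite set set \<Rightarrow> 'v \<Rightarrow> 'v set set" where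
  "hstar E i = {e \<in> E. i \<in> e}"

definition hunits :: "'v::finite set set \<Rightarrow> 'v set set" where
  "hunits E = UNIV // {(i, j). hstar E i = hstar E j}"

definition constant_vecs :: "'v::finite set \<Rightarrow> (real ^ 'v) set" where
  "constant_vecs U = {x. \<exists>c. \<forall>i\<in>U. x $ i = c}"

definition adj1 :: "'v::finite set set \<Rightarrow> real ^ 'v ^ 'v" where
  "adj1 E = (\<chi> i j. if i = j then 0 else real (card (hstar E i \<inter> hstar E j)))"

(* In adj2 and norm_adj a hyperedge containing two distinct vertices has at least two elements,
   so the denominator card e - 1 never vanishes. *)

definition adj2 :: "'v::finite set set \<Rightarrow> real ^ 'v ^ 'v" where
  "adj2 E = (\<chi> i j. if i = j then 0
     else (\<Sum>e \<in> hstar E i \<inter> hstar E j. 1 / (real (card e) - 1)))"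

(* If vertex i lies in no hyperedge, the sum is empty and row i of norm_adj is zero. *)

definition norm_adj :: "'v::finite set set \<Rightarrow> real ^ 'v ^ 'v" where
  "norm_adj E = (\<chi> i j. if i = j then 0
     else 1 / real (card (hstar E i)) *
       (\<Sum>e \<in> hstar E i \<inter> hstar E j. 1 / (real (card e) - 1)))"

definition row_sum_diag :: "real ^ 'v ^ 'v \<Rightarrow> real ^ 'v ^ 'v::finite" where
  "row_sum_diag A = (\<chi> i j. if i = j then (\<Sum>k\<in>UNIV. A $ i $ k) else 0)"

definition laplacian1 :: "'v::finite set set \<Rightarrow> real ^ 'v ^ 'v" where
  "laplacian1 E = row_sum_diag (adj1 E) - adj1 E"

definition laplacian2 :: "'v::finite set set \<Rightarrow> real ^ 'v ^ 'v" where
  "laplacian2 E = row_sum_diag (adj2 E) - adj2 E"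

definition norm_laplacian :: "'v::finite set set \<Rightarrow> real ^ 'v ^ 'v" where
  "norm_laplacian E = mat 1 - norm_adj E"

(* A discrete-time process x(t+1) = f (x(t)) is represented by its one-step map f. *)

definition diffusion :: "real ^ 'v ^ 'v \<Rightarrow> real ^ 'v \<Rightarrow> real ^ 'v::finite" where
  "diffusion L = (\<lambda>x. L *v x)"

definition forward_invariant :: "('a \<Rightarrow> 'a) \<Rightarrow> 'a set \<Rightarrow> bool" where
  "forward_invariant f C \<longleftrightarrow> (\<forall>x\<in>C. f x \<in> C)"

end

theory Submission
  imports Defs
begin

text \<open>
  All three adjacency matrices have off-diagonal entries \<open>g (star i) (star j)\<close> for a fixed function
  \<open>g\<close> of two stars. Supplying the missing diagonal term gives
  \<open>(A x)\<^sub>i = (\<Sum>\<^sub>j g (star i) (star j) x\<^sub>j) - g (star i) (star i) x\<^sub>i\<close>,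
  where the sum runs over all vertices \<open>j\<close>. The right-hand side depends on \<open>i\<close> only through
  \<open>star i\<close> and \<open>x\<^sub>i\<close>, both of which are the same for all \<open>i\<close> in a unit when \<open>x\<close> is constant there
  (lemma \<open>mult_vec_eq_of_same_label\<close>). The identity matrix trivially preserves constancy on the
  unit, and so does the diagonal matrix of row sums, because the row sums form the vector \<open>A 1\<close>,
  to which the same argument applies.
\<close>

lemma mem_constant_vecs_iff:
  "x \<in> constant_vecs U \<longleftrightarrow> (\<forall>i\<in>U. \<forall>k\<in>U. x $ i = x $ k)"
proof
  assume "x \<in> constant_vecs U"
  then show "\<forall>i\<in>U. \<forall>k\<in>U. x $ i = x $ k"
    unfolding constant_vecs_def by auto
next
  assume "\<forall>i\<in>U. \<forall>k\<in>U. x $ i = x $ k"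
  then show "x \<in> constant_vecs U"
    unfolding constant_vecs_def by blast
qed

lemma hstar_eq_of_hunit:
  assumes "W \<in> hunits E" "i \<in> W" "k \<in> W"
  shows "hstar E i = hstar E k"
  using assms unfolding hunits_def quotient_def by auto

text \<open>
  The labels \<open>s i\<close> will be the stars. The rows of \<open>i\<close> and \<open>k\<close> differ only at the two positions
  \<open>i\<close> and \<open>k\<close>, where the zero diagonal entry and \<open>g (s i) (s i)\<close> are interchanged; this swap is
  invisible to a vector with \<open>x\<^sub>i = x\<^sub>k\<close>.
\<close>

lemma mult_vec_eq_of_same_label:
  fixes A :: "real ^ 'v ^ 'v::finite"
  assumes A: "\<And>i j. A $ i $ j = (if i = j then 0 else g (s i) (s j))"
    and s: "s i = s k" and x: "x $ i = x $ k"
  shows "(A *v x) $ i = (A *v x) $ k"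
proof -
  have row: "(A *v x) $ i = (\<Sum>j\<in>UNIV. g (s i) (s j) * x $ j) - g (s i) (s i) * x $ i" for i
  proof -
    have "(A *v x) $ i
        = (\<Sum>j\<in>UNIV. g (s i) (s j) * x $ j - (if i = j then g (s i) (s i) * x $ i else 0))"
      unfolding matrix_vector_mult_def vec_lambda_beta
      by (rule sum.cong) (simp_all add: A)
    then show ?thesis
      by (simp add: sum_subtractf)
  qed
  show ?thesis
    by (simp add: row s x)
qed

lemma row_sum_diag_mult_vec:
  "(row_sum_diag A *v x) $ i = (A *v 1) $ i * x $ i"
  by (simp add: row_sum_diag_def matrix_vector_mult_def if_distrib[where f = "\<lambda>a. a * _"]
      cong: if_cong)

lemma laplacian_mult_vec_eq_of_same_label:
  fixes A :: "real ^ 'v ^ 'v::finite"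
  assumes A: "\<And>i j. A $ i $ j = (if i = j then 0 else g (s i) (s j))"
    and s: "s i = s k" and x: "x $ i = x $ k"
  shows "((row_sum_diag A - A) *v x) $ i = ((row_sum_diag A - A) *v x) $ k"
proof -
  have "(A *v 1) $ i = (A *v 1) $ k"
    by (rule mult_vec_eq_of_same_label[where g = g and s = s, OF A s]) simp
  moreover have "(A *v x) $ i = (A *v x) $ k"
    by (rule mult_vec_eq_of_same_label[where g = g and s = s, OF A s x])
  ultimately show ?thesis
    by (simp add: matrix_vector_mult_diff_rdistrib row_sum_diag_mult_vec x)
qed

theorem theorem3p6:
  fixes E :: "'v::finite set set"
    and W :: "'v set"
    and L :: "real ^ 'v ^ 'v"
  assumes "hypergraph E"
    and "W \<in> hunits E"
    and "L \<in> {laplacian1 E, laplacian2 E, norm_laplacian E}"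
  shows "forward_invariant (diffusion L) (constant_vecs W)"
proof -
  have step: "(L *v x) $ i = (L *v x) $ k"
    if s: "hstar E i = hstar E k" and x: "x $ i = x $ k" for x i k
  proof -
    consider "L = laplacian1 E" | "L = laplacian2 E" | "L = norm_laplacian E"
      using assms(3) by blast
    then show ?thesis
    proof cases
      case 1
      have "adj1 E $ i $ j = (if i = j then 0
          else (\<lambda>S T. real (card (S \<inter> T))) (hstar E i) (hstar E j))" for i j
        by (simp add: adj1_def)
      from laplacian_mult_vec_eq_of_same_label[
          where g = "\<lambda>S T. real (card (S \<inter> T))" and s = "hstar E",
          OF this s x] show ?thesis
        by (simp add: 1 laplacian1_def)
    next
      case 2
      have "adj2 E $ i $ j = (if i = j then 0
          else (\<lambda>S T. \<Sum>e \<in> S \<inter> T. 1 / (real (card e) - 1)) (hstar E i) (hstar E j))" for i j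
        by (simp add: adj2_def)
      from laplacian_mult_vec_eq_of_same_label[
          where g = "\<lambda>S T. \<Sum>e \<in> S \<inter> T. 1 / (real (card e) - 1)" and s = "hstar E",
          OF this s x] show ?thesis
        by (simp add: 2 laplacian2_def)
    next
      case 3
      have "norm_adj E $ i $ j = (if i = j then 0
          else (\<lambda>S T. 1 / real (card S) * (\<Sum>e \<in> S \<inter> T. 1 / (real (card e) - 1)))
            (hstar E i) (hstar E j))" for i j
        by (simp add: norm_adj_def)
      from mult_vec_eq_of_same_label[
          where g = "\<lambda>S T. 1 / real (card S) * (\<Sum>e \<in> S \<inter> T. 1 / (real (card e) - 1))" and s = "hstar E",
          OF this s x] show ?thesis
        by (simp add: 3 norm_laplacian_def matrix_vector_mult_diff_rdistrib x)
    qed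
  qed
  show ?thesis
    unfolding forward_invariant_def diffusion_def mem_constant_vecs_iff[of "L *v _"]
  proof (intro ballI)
    fix x :: "real ^ 'v" and i k
    assume "x \<in> constant_vecs W" and "i \<in> W" "k \<in> W"
    then have "x $ i = x $ k"
      unfolding constant_vecs_def by auto
    with hstar_eq_of_hunit[OF assms(2) \<open>i \<in> W\<close> \<open>k \<in> W\<close>]
    show "(L *v x) $ i = (L *v x) $ k"
      by (rule step)
  qed
qed

end
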